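(* Let $n\ge 1$ and let $F^1(u),\dots,F^n(u)\in\mathbb R((u^1,\dots,u^n))$ be formal Laurent series (or, more generally, let $F^1,\dots,F^n$ be the components of a diffeomorphism $F:\mathbb R^n\to\mathbb R^n$), let $F_{*u}=\left(\frac{\partial F^i(u)}{\partial u^j}\right)$ be the matrix of their partial derivatives, assumed invertible, and let $F_{*u}^{-1}$ be its inverse. Then the $n^2$ formal Laurent series (respectively, smooth functions) $$\varphi^{ij}(u,v)=\sum_{k=1}^{n}\sum_{l=1}^{n}\left(F_{*u}^{-1}\right)^{i}_{k}\left(F_{*v}^{-1}\right)^{j}_{l}\left[F^{k}(u)-F^{l}(v)\right],\qquad i,j=1,\dots,n,$$ satisfy $\varphi^{ij}(u,v)=-\varphi^{ji}(v,u)$ and give a solution of the classical Yang--Baxter equation (CYBE) for the Lie algebra $W_n$ of formal vector fields on $\mathbb R^n$.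
   Context: Notation: $u=(u^1,\dots,u^n)$, $v=(v^1,\dots,v^n)$, $w=(w^1,\dots,w^n)$. $\mathbb R((u^1,\dots,u^n))$ denotes formal Laurent series in which the exponents of each variable are bounded below. In a matrix $(M)^i_k$ the upper index is the row index and the lower index is the column index. A solution of the CYBE for $W_n$ is a family $\varphi^{ij}(u,v)$, $i,j=1,\dots,n$, of formal power series (or formal Laurent series, or smooth functions) with $\varphi^{ij}(u,v)=-\varphi^{ji}(v,u)$ such that for all $i,j,k\in\{1,\dots,n\}$, with summation over the repeated index $s=1,\dots,n$ understood, $$\begin{aligned}&\varphi^{ks}(w,u)\frac{\partial \varphi^{ij}(u,v)}{\partial u^s}+\varphi^{sk}(v,w)\frac{\partial \varphi^{ji}(v,u)}{\partial v^s}+\varphi^{is}(u,v)\frac{\partial \varphi^{jk}(v,w)}{\partial v^s}\\&+\varphi^{si}(w,u)\frac{\partial \varphi^{kj}(w,v)}{\partial w^s}+\varphi^{js}(v,w)\frac{\partial \varphi^{ki}(w,u)}{\partial w^s}+\varphi^{sj}(u,v)\frac{\partial \varphi^{ik}(u,w)}{\partial u^s}=0.\end{aligned}$$ *)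

theory Defs
  imports "HOL-Analysis.Analysis"
begin

section \<open>Formal Laurent series in finitely many variables\<close>

text \<open>
  The finite type \<open>'v\<close> is the set of variables. A series is its coefficient function on
  exponent vectors; in each variable separately the exponents that occur are bounded below.
\<close>

typedef (overloaded) 'v laurent =
  "{f :: int ^ 'v::finite \<Rightarrow> real. \<exists>N :: int ^ 'v. \<forall>e. f e \<noteq> 0 \<longrightarrow> (\<forall>x. N $ x \<le> e $ x)}"
  morphisms lcoeff Abs_laurent
  by (rule exI[of _ "\<lambda>_. 0"]) simp

setup_lifting type_definition_laurent

lemma laurent_eqI: "(\<And>e. lcoeff f e = lcoeff g e) \<Longrightarrow> f = g"
  by (simp add: lcoeff_inject[symmetric] fun_eq_iff)

definition int_box :: "int ^ 'v::finite \<Rightarrow> int ^ 'v \<Rightarrow> (int ^ 'v) set" where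
  "int_box a b = {p. \<forall>x. a $ x \<le> p $ x \<and> p $ x \<le> b $ x}"

lemma finite_int_box: "finite (int_box a b)"
proof -
  have "int_box a b \<subseteq> vec_lambda ` (\<Pi>\<^sub>E x\<in>UNIV. {a $ x .. b $ x})"
  proof
    fix p assume "p \<in> int_box a b"
    then have "(\<lambda>x. p $ x) \<in> (\<Pi>\<^sub>E x\<in>UNIV. {a $ x .. b $ x})"
      by (auto simp: int_box_def)
    moreover have "p = vec_lambda (\<lambda>x. p $ x)" by simp
    ultimately show "p \<in> vec_lambda ` (\<Pi>\<^sub>E x\<in>UNIV. {a $ x .. b $ x})" by blast
  qed
  then show ?thesis
    by (rule finite_subset) (intro finite_imageI finite_PiE; simp)
qed

text \<open>
  Coefficients of a product. For series with exponents bounded below the index set is finite.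
\<close>

definition conv :: "(int ^ 'v::finite \<Rightarrow> real) \<Rightarrow> (int ^ 'v \<Rightarrow> real) \<Rightarrow> int ^ 'v \<Rightarrow> real" where
  "conv f g e = (\<Sum>p | f p \<noteq> 0 \<and> g (e - p) \<noteq> 0. f p * g (e - p))"

definition bdd_supp :: "int ^ 'v::finite \<Rightarrow> (int ^ 'v \<Rightarrow> real) \<Rightarrow> bool" where
  "bdd_supp N f \<longleftrightarrow> (\<forall>e. f e \<noteq> 0 \<longrightarrow> (\<forall>x. N $ x \<le> e $ x))"

lemma conv_supp_subset:
  assumes "bdd_supp a f" "bdd_supp b g"
  shows "{p. f p \<noteq> 0 \<and> g (e - p) \<noteq> 0} \<subseteq> int_box a (e - b)"
proof
  fix p assume "p \<in> {p. f p \<noteq> 0 \<and> g (e - p) \<noteq> 0}"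
  then have "\<forall>x. a $ x \<le> p $ x" "\<forall>x. b $ x \<le> (e - p) $ x"
    using assms unfolding bdd_supp_def by blast+
  then show "p \<in> int_box a (e - b)"
    by (auto simp: int_box_def le_diff_eq add.commute)
qed

lemma conv_eq_sum:
  assumes "finite S" "\<And>p. f p \<noteq> 0 \<Longrightarrow> g (e - p) \<noteq> 0 \<Longrightarrow> p \<in> S"
  shows "conv f g e = (\<Sum>p\<in>S. f p * g (e - p))"
  unfolding conv_def by (rule sum.mono_neutral_left) (use assms in auto)

lemma conv_eq_box:
  assumes "bdd_supp a f" "bdd_supp b g"
  shows "conv f g e = (\<Sum>p\<in>int_box a (e - b). f p * g (e - p))"
  by (rule conv_eq_sum) (use conv_supp_subset[OF assms] finite_int_box in auto)

lemma bdd_supp_conv: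
  assumes "bdd_supp a f" "bdd_supp b g"
  shows "bdd_supp (a + b) (conv f g)"
  unfolding bdd_supp_def
proof (intro allI impI)
  fix e x assume "conv f g e \<noteq> 0"
  then obtain p where "p \<in> int_box a (e - b)"
    unfolding conv_eq_box[OF assms] by (meson sum.not_neutral_contains_not_neutral)
  then have "a $ x \<le> p $ x" "p $ x \<le> (e - b) $ x" by (auto simp: int_box_def)
  then show "(a + b) $ x \<le> e $ x" by simp
qed

lemma conv_assoc:
  assumes f: "bdd_supp a f" and g: "bdd_supp b g" and h: "bdd_supp c h"
  shows "conv (conv f g) h e = conv f (conv g h) e"
proof -
  let ?S = "int_box (a + b) (e - c)" and ?T = "int_box a (e - (b + c))"
  have "conv (conv f g) h e = (\<Sum>p\<in>?S. conv f g p * h (e - p))"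
    by (rule conv_eq_box[OF bdd_supp_conv[OF f g] h])
  also have "\<dots> = (\<Sum>p\<in>?S. (\<Sum>q\<in>?T. f q * g (p - q)) * h (e - p))"
  proof (rule sum.cong[OF refl])
    fix p assume p: "p \<in> ?S"
    have "conv f g p = (\<Sum>q\<in>?T. f q * g (p - q))"
    proof (rule conv_eq_sum[OF finite_int_box])
      fix q assume "f q \<noteq> 0" "g (p - q) \<noteq> 0"
      then have *: "a $ x \<le> q $ x" "b $ x \<le> p $ x - q $ x" for x
        using f g unfolding bdd_supp_def by fastforce+
      have "p $ x + c $ x \<le> e $ x" for x using p by (auto simp: int_box_def le_diff_eq)
      then show "q \<in> ?T"
        using * unfolding int_box_def by (auto simp: algebra_simps) (smt (verit))
    qed
    then show "conv f g p * h (e - p) = (\<Sum>q\<in>?T. f q * g (p - q)) * h (e - p)" by simp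
  qed
  also have "\<dots> = (\<Sum>q\<in>?T. \<Sum>p\<in>?S. f q * (g (p - q) * h (e - p)))"
    by (subst sum.swap) (simp add: sum_distrib_right mult.assoc)
  also have "\<dots> = (\<Sum>q\<in>?T. f q * conv g h (e - q))"
  proof (rule sum.cong[OF refl])
    fix q assume q: "q \<in> ?T"
    have "conv g h (e - q) = (\<Sum>r\<in>(\<lambda>p. p - q) ` ?S. g r * h (e - q - r))"
    proof (rule conv_eq_sum)
      show "finite ((\<lambda>p. p - q) ` ?S)" by (simp add: finite_int_box)
      fix r assume "g r \<noteq> 0" "h (e - q - r) \<noteq> 0"
      then have *: "b $ x \<le> r $ x" "c $ x \<le> e $ x - q $ x - r $ x" for x
        using g h unfolding bdd_supp_def by fastforce+
      have "a $ x \<le> q $ x" for x using q by (auto simp: int_box_def)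
      then have "a $ x + b $ x \<le> r $ x + q $ x" "r $ x + q $ x \<le> e $ x - c $ x" for x
        using *[of x] by (smt (verit))+
      then have "r + q \<in> ?S" by (simp add: int_box_def)
      then show "r \<in> (\<lambda>p. p - q) ` ?S" by (intro image_eqI[of _ _ "r + q"]) simp_all
    qed
    also have "\<dots> = (\<Sum>p\<in>?S. g (p - q) * h (e - p))"
      by (subst sum.reindex) (auto simp: inj_on_def)
    finally show "(\<Sum>p\<in>?S. f q * (g (p - q) * h (e - p))) = f q * conv g h (e - q)"
      by (simp add: sum_distrib_left)
  qed
  also have "\<dots> = conv f (conv g h) e"
    by (rule conv_eq_box[OF f bdd_supp_conv[OF g h], symmetric])
  finally show ?thesis .
qed

lemma conv_commute: "conv f g e = conv g f e"
  unfolding conv_def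
  by (rule sum.reindex_bij_witness[of _ "\<lambda>p. e - p" "\<lambda>p. e - p"]) (auto simp: mult.commute)

lemma bdd_supp_mono: "bdd_supp a f \<Longrightarrow> (\<And>x. b $ x \<le> a $ x) \<Longrightarrow> bdd_supp b f"
  unfolding bdd_supp_def by (meson order_trans)

lemma bdd_supp_add:
  assumes "bdd_supp a f" "bdd_supp b g"
  shows "bdd_supp (\<chi> x. min (a $ x) (b $ x)) (\<lambda>e. f e + g e)"
  unfolding bdd_supp_def
proof (intro allI impI)
  fix e x assume "f e + g e \<noteq> 0"
  then have "f e \<noteq> 0 \<or> g e \<noteq> 0" by auto
  then have "a $ x \<le> e $ x \<or> b $ x \<le> e $ x" using assms unfolding bdd_supp_def by blast
  then show "(\<chi> x. min (a $ x) (b $ x)) $ x \<le> e $ x" by (simp add: min_le_iff_disj)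
qed

lemma bdd_supp_lcoeff: "\<exists>N. bdd_supp N (lcoeff f)"
  using lcoeff[of f] by (simp add: bdd_supp_def)

instantiation laurent :: (finite) comm_ring_1
begin

lift_definition zero_laurent :: "'a laurent" is "\<lambda>_. 0" by simp

lift_definition one_laurent :: "'a laurent" is "\<lambda>e. if e = 0 then 1 else 0"
  by (rule exI[of _ 0]) auto

lift_definition plus_laurent :: "'a laurent \<Rightarrow> 'a laurent \<Rightarrow> 'a laurent" is
  "\<lambda>f g e. f e + g e"
  using bdd_supp_add unfolding bdd_supp_def by blast

lift_definition uminus_laurent :: "'a laurent \<Rightarrow> 'a laurent" is "\<lambda>f e. - f e" by simp

definition minus_laurent :: "'a laurent \<Rightarrow> 'a laurent \<Rightarrow> 'a laurent" where
  "minus_laurent f g = f + - g"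

lift_definition times_laurent :: "'a laurent \<Rightarrow> 'a laurent \<Rightarrow> 'a laurent" is conv
  using bdd_supp_conv unfolding bdd_supp_def by blast

instance
proof
  fix f g h :: "'a laurent"
  show "f + g + h = f + (g + h)" by transfer (simp add: add.assoc)
  show "f + g = g + f" by transfer (simp add: add.commute)
  show "0 + f = f" by transfer simp
  show "- f + f = 0" by transfer simp
  show "f - g = f + - g" by (rule minus_laurent_def)
  obtain a b c where *: "bdd_supp a (lcoeff f)" "bdd_supp b (lcoeff g)" "bdd_supp c (lcoeff h)"
    using bdd_supp_lcoeff by metis
  show "f * g * h = f * (g * h)"
    by (rule laurent_eqI) (simp add: times_laurent.rep_eq conv_assoc[OF *])
  show "f * g = g * f"
    by (rule laurent_eqI) (simp add: times_laurent.rep_eq conv_commute)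
  show "1 * f = f"
    by (rule laurent_eqI)
       (subst times_laurent.rep_eq, subst conv_eq_sum[of "{0}"],
        auto simp: one_laurent.rep_eq split: if_splits)
  show "(f + g) * h = f * h + g * h"
  proof (rule laurent_eqI)
    fix e
    let ?m = "\<chi> x. min (a $ x) (b $ x)"
    have "bdd_supp ?m (lcoeff f)" "bdd_supp ?m (lcoeff g)"
      by (rule bdd_supp_mono[OF *(1)], simp) (rule bdd_supp_mono[OF *(2)], simp)
    then show "lcoeff ((f + g) * h) e = lcoeff (f * h + g * h) e"
      using bdd_supp_add[OF *(1,2)] *(3)
      by (simp add: times_laurent.rep_eq plus_laurent.rep_eq conv_eq_box distrib_right sum.distrib)
  qed
  show "(0 :: 'a laurent) \<noteq> 1"
    by (simp add: lcoeff_inject[symmetric] zero_laurent.rep_eq one_laurent.rep_eq fun_eq_iff exI[of _ 0])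
qed

end

lemma lpderiv_bounded:
  fixes f :: "int ^ 'v::finite \<Rightarrow> real"
  assumes "\<exists>N :: int ^ 'v. \<forall>e x. f e \<noteq> 0 \<longrightarrow> N $ x \<le> e $ x"
  shows "\<exists>N :: int ^ 'v. \<forall>e y. of_int (e $ x + 1) * f (e + axis x 1) \<noteq> 0 \<longrightarrow> N $ y \<le> e $ y"
proof -
  from assms obtain N where N: "\<And>e y. f e \<noteq> 0 \<Longrightarrow> N $ y \<le> e $ y" by blast
  show ?thesis
  proof (intro exI[of _ "N - axis x 1"] allI impI)
    fix e y assume "of_int (e $ x + 1) * f (e + axis x 1) \<noteq> 0"
    then have "f (e + axis x 1) \<noteq> 0" by simp
    then have "N $ y \<le> (e + axis x 1) $ y" by (rule N)
    then show "(N - axis x 1) $ y \<le> e $ y" by simp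
  qed
qed

text \<open>The formal partial derivative with respect to the variable \<open>x\<close>.\<close>

lift_definition lpderiv :: "'v::finite \<Rightarrow> 'v laurent \<Rightarrow> 'v laurent" is
  "\<lambda>x f e. of_int (e $ x + 1) * f (e + axis x 1)"
  by (rule lpderiv_bounded)

lemma lrename_bounded:
  fixes f :: "int ^ 'v::finite \<Rightarrow> real" and \<rho> :: "'v \<Rightarrow> 'w::finite"
  assumes "\<exists>N :: int ^ 'v. \<forall>e x. f e \<noteq> 0 \<longrightarrow> N $ x \<le> e $ x"
  shows "\<exists>N :: int ^ 'w. \<forall>e y. (if \<forall>y. y \<notin> range \<rho> \<longrightarrow> e $ y = 0 then f (\<chi> x. e $ \<rho> x) else 0) \<noteq> 0
          \<longrightarrow> N $ y \<le> e $ y"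
proof -
  from assms obtain N where N: "\<And>e x. f e \<noteq> 0 \<Longrightarrow> N $ x \<le> e $ x" by blast
  define B where "B = Min (insert 0 (range (\<lambda>x. N $ x)))"
  have B: "B \<le> 0" "\<And>x. B \<le> N $ x" unfolding B_def by (intro Min_le; simp)+
  show ?thesis
  proof (intro exI[of _ "\<chi> _. B"] allI impI)
    fix e y assume *: "(if \<forall>y. y \<notin> range \<rho> \<longrightarrow> e $ y = 0 then f (\<chi> x. e $ \<rho> x) else 0) \<noteq> 0"
    show "(\<chi> _. B) $ y \<le> e $ y"
    proof (cases "y \<in> range \<rho>")
      case True
      then obtain x where "y = \<rho> x" by blast
      moreover from * have "N $ x \<le> (\<chi> x. e $ \<rho> x) $ x" by (intro N) (auto split: if_splits)
      ultimately show ?thesis using B(2)[of x] by simp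
    next
      case False
      with * B(1) show ?thesis by (auto split: if_splits)
    qed
  qed
qed

text \<open>
  Renaming each variable \<open>x\<close> to \<open>\<rho> x\<close>. The monomials of the result have exponent 0 in the
  variables outside the range of \<open>\<rho>\<close>. The coefficient formula is the right one only for
  injective \<open>\<rho>\<close>, and all uses below are injective.
\<close>

lift_definition lrename :: "('v::finite \<Rightarrow> 'w::finite) \<Rightarrow> 'v laurent \<Rightarrow> 'w laurent" is
  "\<lambda>\<rho> f e. if \<forall>y. y \<notin> range \<rho> \<longrightarrow> e $ y = 0 then f (\<chi> x. e $ \<rho> x) else 0"
  by (rule lrename_bounded)


section \<open>The classical Yang--Baxter equation for formal Laurent series\<close>

text \<open>
  The index type \<open>'n\<close> plays the role of \<open>{1,\<dots>,n}\<close>. A series in \<open>(u,v)\<close> has the variables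
  \<open>'n + 'n\<close>: \<open>Inl i\<close> is the \<open>i\<close>-th component of \<open>u\<close>, \<open>Inr i\<close> that of \<open>v\<close>. The equation
  itself lives in the series in \<open>(u,v,w)\<close>, with variables \<open>'n + 'n + 'n\<close>.
\<close>

abbreviation var_u :: "'n \<Rightarrow> 'n + 'n + 'n" where "var_u \<equiv> Inl"
abbreviation var_v :: "'n \<Rightarrow> 'n + 'n + 'n" where "var_v \<equiv> \<lambda>i. Inr (Inl i)"
abbreviation var_w :: "'n \<Rightarrow> 'n + 'n + 'n" where "var_w \<equiv> \<lambda>i. Inr (Inr i)"

definition at_vars ::
  "('n::finite + 'n) laurent \<Rightarrow> ('n \<Rightarrow> 'w::finite) \<Rightarrow> ('n \<Rightarrow> 'w) \<Rightarrow> 'w laurent" where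
  "at_vars f x y = lrename (case_sum x y) f"

definition laurent_skew :: "('n::finite \<Rightarrow> 'n \<Rightarrow> ('n + 'n) laurent) \<Rightarrow> bool" where
  "laurent_skew \<phi> \<longleftrightarrow> (\<forall>i j. at_vars (\<phi> i j) Inl Inr = - at_vars (\<phi> j i) Inr Inl)"

definition laurent_CYBE_solution :: "('n::finite \<Rightarrow> 'n \<Rightarrow> ('n + 'n) laurent) \<Rightarrow> bool" where
  "laurent_CYBE_solution \<phi> \<longleftrightarrow>
     laurent_skew \<phi> \<and>
     (\<forall>i j k. (\<Sum>s\<in>UNIV.
          at_vars (\<phi> k s) var_w var_u * lpderiv (var_u s) (at_vars (\<phi> i j) var_u var_v)
        + at_vars (\<phi> s k) var_v var_w * lpderiv (var_v s) (at_vars (\<phi> j i) var_v var_u)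
        + at_vars (\<phi> i s) var_u var_v * lpderiv (var_v s) (at_vars (\<phi> j k) var_v var_w)
        + at_vars (\<phi> s i) var_w var_u * lpderiv (var_w s) (at_vars (\<phi> k j) var_w var_v)
        + at_vars (\<phi> j s) var_v var_w * lpderiv (var_w s) (at_vars (\<phi> k i) var_w var_u)
        + at_vars (\<phi> s j) var_u var_v * lpderiv (var_u s) (at_vars (\<phi> i k) var_u var_w)) = 0)"

definition laurent_jacobian :: "'n::finite laurent ^ 'n \<Rightarrow> 'n laurent ^ 'n ^ 'n" where
  "laurent_jacobian F = (\<chi> i j. lpderiv j (F $ i))"

definition laurent_phi :: "'n::finite laurent ^ 'n \<Rightarrow> 'n \<Rightarrow> 'n \<Rightarrow> ('n + 'n) laurent" where
  "laurent_phi F i j =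
     (\<Sum>k\<in>UNIV. \<Sum>l\<in>UNIV.
        lrename Inl (matrix_inv (laurent_jacobian F) $ i $ k)
      * lrename Inr (matrix_inv (laurent_jacobian F) $ j $ l)
      * (lrename Inl (F $ k) - lrename Inr (F $ l)))"


section \<open>The classical Yang--Baxter equation for smooth functions\<close>

primrec C_k :: "nat \<Rightarrow> ('a::euclidean_space \<Rightarrow> 'b::real_normed_vector) \<Rightarrow> bool" where
  "C_k 0 f \<longleftrightarrow> continuous_on UNIV f"
| "C_k (Suc k) f \<longleftrightarrow>
     (\<forall>x. f differentiable (at x)) \<and> (\<forall>b\<in>Basis. C_k k (\<lambda>x. frechet_derivative f (at x) b))"

definition smooth :: "('a::euclidean_space \<Rightarrow> 'b::real_normed_vector) \<Rightarrow> bool" where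
  "smooth f \<longleftrightarrow> (\<forall>k. C_k k f)"

definition diffeomorphism :: "('a::euclidean_space \<Rightarrow> 'b::euclidean_space) \<Rightarrow> bool" where
  "diffeomorphism F \<longleftrightarrow> smooth F \<and> bij F \<and> smooth (inv F)"

definition pderiv_at :: "'n::finite \<Rightarrow> (real ^ 'n \<Rightarrow> real) \<Rightarrow> real ^ 'n \<Rightarrow> real" where
  "pderiv_at s f x = frechet_derivative f (at x) (axis s 1)"

definition smooth_skew ::
  "('n::finite \<Rightarrow> 'n \<Rightarrow> real ^ 'n \<Rightarrow> real ^ 'n \<Rightarrow> real) \<Rightarrow> bool" where
  "smooth_skew \<phi> \<longleftrightarrow> (\<forall>i j u v. \<phi> i j u v = - \<phi> j i v u)"

definition smooth_CYBE_solution ::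
  "('n::finite \<Rightarrow> 'n \<Rightarrow> real ^ 'n \<Rightarrow> real ^ 'n \<Rightarrow> real) \<Rightarrow> bool" where
  "smooth_CYBE_solution \<phi> \<longleftrightarrow>
     (\<forall>i j. smooth (\<lambda>(u, v). \<phi> i j u v)) \<and>
     smooth_skew \<phi> \<and>
     (\<forall>i j k u v w. (\<Sum>s\<in>UNIV.
          \<phi> k s w u * pderiv_at s (\<lambda>u. \<phi> i j u v) u
        + \<phi> s k v w * pderiv_at s (\<lambda>v. \<phi> j i v u) v
        + \<phi> i s u v * pderiv_at s (\<lambda>v. \<phi> j k v w) v
        + \<phi> s i w u * pderiv_at s (\<lambda>w. \<phi> k j w v) w
        + \<phi> j s v w * pderiv_at s (\<lambda>w. \<phi> k i w u) w
        + \<phi> s j u v * pderiv_at s (\<lambda>u. \<phi> i k u w) u) = 0)"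

definition smooth_phi ::
  "(real ^ 'n \<Rightarrow> real ^ 'n) \<Rightarrow> 'n::finite \<Rightarrow> 'n \<Rightarrow> real ^ 'n \<Rightarrow> real ^ 'n \<Rightarrow> real" where
  "smooth_phi F i j u v =
     (\<Sum>k\<in>UNIV. \<Sum>l\<in>UNIV.
        matrix_inv (jacobian F (at u)) $ i $ k
      * matrix_inv (jacobian F (at v)) $ j $ l
      * (F u $ k - F v $ l))"

end

theory Submission
  imports Defs
begin

text \<open>
  Put \<open>J\<close> for the Jacobian matrix of \<open>F\<close>, and let \<open>e = J\<inverse> 1\<close> and \<open>X = J\<inverse> F\<close>, where \<open>1\<close> is the
  constant column of ones. In the coordinates \<open>F\<close> these are the vector field \<open>\<Sum>k. \<partial>/\<partial>F\<^sup>k\<close> of simultaneous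
  translation and the Euler field \<open>\<Sum>k. F\<^sup>k \<partial>/\<partial>F\<^sup>k\<close>. The double sum factors as
  \<open>\<phi>\<^sup>i\<^sup>j(u,v) = X\<^sup>i(u) e\<^sup>j(v) - e\<^sup>i(u) X\<^sup>j(v)\<close>, so that \<open>\<phi> = X \<and> e\<close> and the skew symmetry is visible. Since
  \<open>[e, X] = e\<close>, the two fields span a two-dimensional Lie algebra, and \<open>X \<and> e\<close> is the classical
  triangular solution of the CYBE attached to it.

  Two purely algebraic lemmas carry the argument. Lemma \<open>shift_euler_bracket\<close> obtains \<open>[e, X] = e\<close> from
  \<open>J e = 1\<close>, \<open>J X = F\<close>, their first derivatives, and the symmetry of the second derivatives of \<open>F\<close>,
  without a formula for the derivative of \<open>J\<inverse>\<close>. Lemma \<open>wedge_solves_CYBE\<close> groups the six terms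
  of the CYBE in pairs by the point of differentiation; each pair is a multiple of the bracket
  at that point, and after \<open>[e, X] = e\<close> is inserted the three contributions cancel.

  Both lemmas live in an arbitrary commutative ring and treat derivatives as given elements. They are
  applied to Laurent series, where the formal partial derivatives are commuting derivations
  and injective renamings of variables are ring homomorphisms that intertwine them, and to the real
  values of smooth functions at points. In the smooth case the remaining analytic facts are
  the commutation of mixed partial derivatives and the smoothness of the entries of \<open>J\<inverse>\<close>. The latter is a
  bootstrap: the entries are differentiable because \<open>J\<inverse>(u)\<close> is the Jacobian of the inverse map at
  \<open>F(u)\<close>, and \<open>\<partial>J\<inverse> = - J\<inverse> (\<partial>J) J\<inverse>\<close> then raises the order of differentiability by induction.
\<close>

section \<open>The bracket relation and the Yang--Baxter identity in a commutative ring\<close>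

text \<open>
  Here \<open>J a i\<close> stands for \<open>\<partial>\<^sub>i F\<^sup>a\<close> and \<open>G\<close> for its inverse matrix, \<open>dJ s a i\<close> for \<open>\<partial>\<^sub>s\<partial>\<^sub>i F\<^sup>a\<close>, and \<open>de s i\<close>, \<open>dX s i\<close>
  for \<open>\<partial>\<^sub>s e\<^sup>i\<close>, \<open>\<partial>\<^sub>s X\<^sup>i\<close>. The last two hypotheses are \<open>J e = 1\<close> and \<open>J X = F\<close> after differentiation, and the
  conclusion reads \<open>[e, X] = e\<close>. Both sides agree after multiplication by \<open>J\<close>, because the second
  derivatives enter only through \<open>\<Sum> dJ s a i e\<^sup>s X\<^sup>i\<close>, which is symmetric in \<open>e\<close> and \<open>X\<close>.
\<close>

lemma shift_euler_bracket:
  fixes J G :: "'n::finite \<Rightarrow> 'n \<Rightarrow> 'a::comm_ring_1"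
  assumes GJ: "\<And>i j. (\<Sum>a\<in>UNIV. G i a * J a j) = (if i = j then 1 else 0)"
    and sym: "\<And>s a i. dJ s a i = dJ i a s"
    and Je: "\<And>a. (\<Sum>i\<in>UNIV. J a i * e i) = 1"
    and dJe: "\<And>a s. (\<Sum>i\<in>UNIV. dJ s a i * e i + J a i * de s i) = 0"
    and dJX: "\<And>a s. (\<Sum>i\<in>UNIV. dJ s a i * X i + J a i * dX s i) = J a s"
  shows "(\<Sum>s\<in>UNIV. e s * dX s i - X s * de s i) = e i"
proof -
  define B where "B i = (\<Sum>s\<in>UNIV. e s * dX s i - X s * de s i) - e i" for i
  have JB: "(\<Sum>i\<in>UNIV. J a i * B i) = 0" for a
  proof -
    have 1: "(\<Sum>i\<in>UNIV. J a i * de s i) = - (\<Sum>i\<in>UNIV. dJ s a i * e i)" for s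
      using dJe[of s a] by (simp add: sum.distrib eq_neg_iff_add_eq_0 add.commute)
    have 2: "(\<Sum>i\<in>UNIV. J a i * dX s i) = J a s - (\<Sum>i\<in>UNIV. dJ s a i * X i)" for s
      using dJX[of s a] by (simp add: sum.distrib eq_diff_eq add.commute)
    have "(\<Sum>i\<in>UNIV. J a i * B i)
        = (\<Sum>i\<in>UNIV. \<Sum>s\<in>UNIV. e s * (J a i * dX s i) - X s * (J a i * de s i)) - (\<Sum>i\<in>UNIV. J a i * e i)"
      unfolding B_def by (simp add: right_diff_distrib sum_subtractf sum_distrib_left mult.left_commute)
    also have "(\<Sum>i\<in>UNIV. \<Sum>s\<in>UNIV. e s * (J a i * dX s i) - X s * (J a i * de s i))
        = (\<Sum>s\<in>UNIV. e s * (\<Sum>i\<in>UNIV. J a i * dX s i) - X s * (\<Sum>i\<in>UNIV. J a i * de s i))"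
      by (subst sum.swap) (simp add: sum_subtractf sum_distrib_left)
    also have "\<dots> = (\<Sum>s\<in>UNIV. J a s * e s) - (\<Sum>s\<in>UNIV. \<Sum>i\<in>UNIV. dJ s a i * (e s * X i))
        + (\<Sum>s\<in>UNIV. \<Sum>i\<in>UNIV. dJ s a i * (X s * e i))"
      unfolding 1 2
      by (simp add: right_diff_distrib sum_subtractf sum.distrib sum_distrib_left sum_negf mult_ac)
    also have "(\<Sum>s\<in>UNIV. \<Sum>i\<in>UNIV. dJ s a i * (X s * e i)) = (\<Sum>s\<in>UNIV. \<Sum>i\<in>UNIV. dJ s a i * (e s * X i))"
      by (subst sum.swap, subst sym) (simp add: mult.commute)
    finally show ?thesis by (simp add: Je)
  qed
  \<comment> \<open>multiplication of \<open>J B = 0\<close> by the left inverse \<open>G\<close>\<close>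
  have "B i = (\<Sum>j\<in>UNIV. (if i = j then 1 else 0) * B j)"
    by (simp add: mult_if_delta)
  also have "\<dots> = (\<Sum>j\<in>UNIV. \<Sum>a\<in>UNIV. G i a * (J a j * B j))"
    by (simp add: GJ[symmetric] sum_distrib_right mult.assoc)
  also have "\<dots> = (\<Sum>a\<in>UNIV. G i a * (\<Sum>j\<in>UNIV. J a j * B j))"
    by (subst sum.swap) (simp add: sum_distrib_left)
  finally have "B i = 0" by (simp add: JB)
  then show ?thesis by (simp add: B_def)
qed

text \<open>
  The suffixes \<open>u\<close>, \<open>v\<close>, \<open>w\<close> mark the values of \<open>e\<close>, \<open>X\<close> and of their derivatives at three points (or in
  three disjoint sets of variables); each hypothesis is \<open>[e, X] = e\<close> at one of them.
\<close>

lemma wedge_solves_CYBE: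
  fixes eu Xu ev Xv ew Xw :: "'n::finite \<Rightarrow> 'a::comm_ring_1"
  assumes u: "\<And>i. (\<Sum>s\<in>UNIV. eu s * dXu s i - Xu s * deu s i) = eu i"
    and v: "\<And>i. (\<Sum>s\<in>UNIV. ev s * dXv s i - Xv s * dev s i) = ev i"
    and w: "\<And>i. (\<Sum>s\<in>UNIV. ew s * dXw s i - Xw s * dew s i) = ew i"
  shows "(\<Sum>s\<in>UNIV.
       (Xw k * eu s - ew k * Xu s) * (dXu s i * ev j - deu s i * Xv j)
     + (Xv s * ew k - ev s * Xw k) * (dXv s j * eu i - dev s j * Xu i)
     + (Xu i * ev s - eu i * Xv s) * (dXv s j * ew k - dev s j * Xw k)
     + (Xw s * eu i - ew s * Xu i) * (dXw s k * ev j - dew s k * Xv j)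
     + (Xv j * ew s - ev j * Xw s) * (dXw s k * eu i - dew s k * Xu i)
     + (Xu s * ev j - eu s * Xv j) * (dXu s i * ew k - deu s i * Xw k)) = 0"
    (is "(\<Sum>s\<in>UNIV. ?t s) = 0")
proof -
  \<comment> \<open>terms 1 and 6 differentiate in \<open>u\<close>, terms 2 and 3 in \<open>v\<close>, terms 4 and 5 in \<open>w\<close>\<close>
  have "?t s = (ev j * Xw k - Xv j * ew k) * (eu s * dXu s i - Xu s * deu s i)
      + (Xu i * ew k - eu i * Xw k) * (ev s * dXv s j - Xv s * dev s j)
      + (eu i * Xv j - Xu i * ev j) * (ew s * dXw s k - Xw s * dew s k)" for s
    by (simp add: algebra_simps)
  then have "(\<Sum>s\<in>UNIV. ?t s) = (ev j * Xw k - Xv j * ew k) * eu i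
      + (Xu i * ew k - eu i * Xw k) * ev j + (eu i * Xv j - Xu i * ev j) * ew k"
    by (simp only: sum.distrib sum_distrib_left[symmetric] u v w)
  then show ?thesis by (simp add: algebra_simps)
qed

lemma matrix_inv_of_invertible:
  fixes A :: "'a::semiring_1 ^ 'n ^ 'm"
  assumes "invertible A"
  shows "A ** matrix_inv A = mat 1" "matrix_inv A ** A = mat 1"
  using someI_ex[OF assms[unfolded invertible_def]] by (simp_all add: matrix_inv_def)

lemma matrix_mult_eq_one_iff:
  fixes A :: "'a::semiring_1 ^ 'n ^ 'm" and B :: "'a ^ 'm ^ 'n"
  shows "A ** B = mat 1 \<longleftrightarrow> (\<forall>i j. (\<Sum>k\<in>UNIV. A $ i $ k * B $ k $ j) = (if i = j then 1 else 0))"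
  by (simp add: matrix_matrix_mult_def mat_def vec_eq_iff)

lemma right_inverse_apply:
  fixes A B :: "'a::comm_ring_1 ^ 'n ^ 'n"
  assumes "A ** B = mat 1"
  shows "(\<Sum>i\<in>UNIV. A $ a $ i * (\<Sum>k\<in>UNIV. B $ i $ k * y k)) = y a"
proof -
  have "(\<Sum>i\<in>UNIV. A $ a $ i * (\<Sum>k\<in>UNIV. B $ i $ k * y k))
      = (\<Sum>k\<in>UNIV. (\<Sum>i\<in>UNIV. A $ a $ i * B $ i $ k) * y k)"
    by (simp add: sum_distrib_left sum_distrib_right mult.assoc) (rule sum.swap)
  also have "\<dots> = (\<Sum>k\<in>UNIV. (if a = k then 1 else 0) * y k)"
    using assms by (simp add: matrix_mult_eq_one_iff)
  also have "\<dots> = y a" by (simp add: mult_if_delta)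
  finally show ?thesis .
qed

section \<open>Formal derivatives and renamings of Laurent series\<close>

lemma lpderiv_add: "lpderiv x (f + g) = lpderiv x f + lpderiv x g"
  by (rule laurent_eqI) (simp add: lpderiv.rep_eq plus_laurent.rep_eq algebra_simps)

lemma lpderiv_zero [simp]: "lpderiv x 0 = 0"
  by (rule laurent_eqI) (simp add: lpderiv.rep_eq zero_laurent.rep_eq)

lemma lpderiv_minus: "lpderiv x (- f) = - lpderiv x f"
  by (rule laurent_eqI) (simp add: lpderiv.rep_eq uminus_laurent.rep_eq)

lemma lpderiv_diff: "lpderiv x (f - g) = lpderiv x f - lpderiv x g"
  by (simp only: minus_laurent_def lpderiv_add lpderiv_minus)

lemma lpderiv_sum: "lpderiv x (\<Sum>i\<in>A. f i) = (\<Sum>i\<in>A. lpderiv x (f i))"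
  by (induction A rule: infinite_finite_induct) (auto simp: lpderiv_add)

lemma lpderiv_one [simp]: "lpderiv (x :: 'a::finite) 1 = 0"
proof (rule laurent_eqI)
  fix e :: "int ^ 'a"
  have "e + axis x 1 = 0 \<Longrightarrow> e $ x + 1 = 0"
    by (drule arg_cong[of _ _ "\<lambda>p. p $ x"]) simp
  then show "lcoeff (lpderiv x 1) e = lcoeff 0 e"
    by (simp only: lpderiv.rep_eq one_laurent.rep_eq zero_laurent.rep_eq) (simp del: of_int_add)
qed

text \<open>
  The Leibniz rule comes from splitting the factor \<open>e\<^sub>x + 1\<close> of the coefficient as \<open>p\<^sub>x + (e\<^sub>x - p\<^sub>x + 1)\<close>
  in the product with summation index \<open>p\<close>.
\<close>

lemma lpderiv_mult: "lpderiv x (f * g) = lpderiv x f * g + f * lpderiv x g"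
proof (rule laurent_eqI)
  fix e
  define d :: "int ^ 'a" where "d = axis x 1"
  have dx: "d $ x = 1" by (simp add: d_def)
  obtain a b where ab: "bdd_supp a (lcoeff f)" "bdd_supp b (lcoeff g)"
    using bdd_supp_lcoeff by metis
  let ?S = "int_box a (e + d - b)"
  let ?c = "\<lambda>p. lcoeff f p * lcoeff g (e + d - p)"
  \<comment> \<open>one finite index set, that of the product at the shifted exponent, serves all three sums\<close>
  have in_S: "p \<in> ?S" if "lcoeff f p \<noteq> 0" "lcoeff g (e + d - p) \<noteq> 0" for p
    using conv_supp_subset[OF ab, of "e + d"] that by auto
  have fg: "lcoeff (f * g) (e + d) = (\<Sum>p\<in>?S. ?c p)"
    unfolding times_laurent.rep_eq by (rule conv_eq_box[OF ab])
  have "lcoeff (lpderiv x f * g) e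
      = (\<Sum>p\<in>(\<lambda>p. p - d) ` ?S. of_int (p $ x + 1) * lcoeff f (p + d) * lcoeff g (e - p))"
    unfolding times_laurent.rep_eq lpderiv.rep_eq d_def[symmetric]
  proof (rule conv_eq_sum)
    fix p assume "of_int (p $ x + 1) * lcoeff f (p + d) \<noteq> 0" "lcoeff g (e - p) \<noteq> 0"
    then have "p + d \<in> ?S" by (intro in_S) auto
    then show "p \<in> (\<lambda>p. p - d) ` ?S" by (intro image_eqI[of _ _ "p + d"]) simp_all
  qed (simp add: finite_int_box)
  also have "\<dots> = (\<Sum>p\<in>?S. of_int (p $ x) * ?c p)"
    by (subst sum.reindex) (auto simp: inj_on_def dx algebra_simps)
  finally have f'g: "lcoeff (lpderiv x f * g) e = (\<Sum>p\<in>?S. of_int (p $ x) * ?c p)" .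
  have "lcoeff (f * lpderiv x g) e
      = (\<Sum>p\<in>?S. lcoeff f p * (of_int ((e - p) $ x + 1) * lcoeff g (e - p + d)))"
    unfolding times_laurent.rep_eq lpderiv.rep_eq d_def[symmetric]
    by (rule conv_eq_sum[OF finite_int_box], rule in_S) (auto simp: algebra_simps)
  also have "\<dots> = (\<Sum>p\<in>?S. of_int (e $ x - p $ x + 1) * ?c p)"
    by (simp add: algebra_simps)
  finally have fg': "lcoeff (f * lpderiv x g) e = (\<Sum>p\<in>?S. of_int (e $ x - p $ x + 1) * ?c p)" .
  have "lcoeff (lpderiv x (f * g)) e = (\<Sum>p\<in>?S. of_int (e $ x + 1) * ?c p)"
    by (simp only: lpderiv.rep_eq d_def[symmetric] fg sum_distrib_left)
  also have "\<dots> = lcoeff (lpderiv x f * g) e + lcoeff (f * lpderiv x g) e"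
    unfolding f'g fg' sum.distrib[symmetric] by (rule sum.cong) (auto simp: algebra_simps)
  finally show "lcoeff (lpderiv x (f * g)) e = lcoeff (lpderiv x f * g + f * lpderiv x g) e"
    by (simp add: plus_laurent.rep_eq)
qed

lemma lpderiv_commute: "lpderiv x (lpderiv y f) = lpderiv y (lpderiv x f)"
  by (cases "x = y", simp, rule laurent_eqI)
    (simp add: lpderiv.rep_eq axis_def algebra_simps)

lemma lrename_add: "lrename \<rho> (f + g) = lrename \<rho> f + lrename \<rho> g"
  by (rule laurent_eqI) (simp add: lrename.rep_eq plus_laurent.rep_eq del: not_all)

lemma lrename_zero [simp]: "lrename \<rho> 0 = 0"
  by (rule laurent_eqI) (simp add: lrename.rep_eq zero_laurent.rep_eq)

lemma lrename_minus: "lrename \<rho> (- f) = - lrename \<rho> f"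
  by (rule laurent_eqI) (simp add: lrename.rep_eq uminus_laurent.rep_eq del: not_all)

lemma lrename_diff: "lrename \<rho> (f - g) = lrename \<rho> f - lrename \<rho> g"
  by (simp only: minus_laurent_def lrename_add lrename_minus)

lemma lrename_sum: "lrename \<rho> (\<Sum>i\<in>A. f i) = (\<Sum>i\<in>A. lrename \<rho> (f i))"
  by (induction A rule: infinite_finite_induct) (auto simp: lrename_add)

lemma lrename_mult:
  fixes \<rho> :: "'a::finite \<Rightarrow> 'b::finite"
  assumes "inj \<rho>"
  shows "lrename \<rho> (f * g) = lrename \<rho> f * lrename \<rho> g"
proof (rule laurent_eqI)
  fix e :: "int ^ 'b"
  define off :: "int ^ 'b \<Rightarrow> bool" where "off e \<longleftrightarrow> (\<forall>y. y \<notin> range \<rho> \<longrightarrow> e $ y = 0)" for e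
  let ?res = "\<lambda>e. \<chi> x. e $ \<rho> x"
  have lc: "lcoeff (lrename \<rho> h) p = (if off p then lcoeff h (?res p) else 0)" for h p
    by (simp add: lrename.rep_eq off_def)
  \<comment> \<open>the extension by \<open>0\<close> of an exponent vector inverts the restriction along \<open>\<rho>\<close>\<close>
  define ext :: "int ^ 'a \<Rightarrow> int ^ 'b"
    where "ext p = (\<chi> y. if y \<in> range \<rho> then p $ inv \<rho> y else 0)" for p
  have res_ext: "?res (ext p) = p" for p
    using assms by (simp add: ext_def vec_eq_iff)
  have off_ext: "off (ext p)" for p by (simp add: ext_def off_def)
  have ext_res: "ext (?res p) = p" if "off p" for p
    using that assms by (auto simp: off_def ext_def vec_eq_iff f_inv_into_f)
  have res_diff: "?res (p - q) = ?res p - ?res q" for p q by (simp add: vec_eq_iff)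
  show "lcoeff (lrename \<rho> (f * g)) e = lcoeff (lrename \<rho> f * lrename \<rho> g) e"
  proof (cases "off e")
    case True
    then have "lcoeff (lrename \<rho> (f * g)) e = conv (lcoeff f) (lcoeff g) (?res e)"
      by (simp add: lc times_laurent.rep_eq)
    also have "\<dots> = conv (lcoeff (lrename \<rho> f)) (lcoeff (lrename \<rho> g)) e"
      unfolding conv_def
    proof (rule sum.reindex_bij_witness[of _ ?res ext])
      fix p assume p: "p \<in> {p. lcoeff f p \<noteq> 0 \<and> lcoeff g (?res e - p) \<noteq> 0}"
      have off': "off (e - ext p)" using True off_ext by (simp add: off_def)
      have 1: "lcoeff (lrename \<rho> f) (ext p) = lcoeff f p"
        "lcoeff (lrename \<rho> g) (e - ext p) = lcoeff g (?res e - p)"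
        using off_ext off' by (simp_all only: lc res_ext res_diff if_True)
      then show "ext p \<in> {p. lcoeff (lrename \<rho> f) p \<noteq> 0 \<and> lcoeff (lrename \<rho> g) (e - p) \<noteq> 0}"
        using p by simp
      show "lcoeff (lrename \<rho> f) (ext p) * lcoeff (lrename \<rho> g) (e - ext p)
          = lcoeff f p * lcoeff g (?res e - p)"
        using 1 by simp
      show "?res (ext p) = p" by (rule res_ext)
    next
      fix q assume "q \<in> {p. lcoeff (lrename \<rho> f) p \<noteq> 0 \<and> lcoeff (lrename \<rho> g) (e - p) \<noteq> 0}"
      then have q: "off q" "lcoeff f (?res q) \<noteq> 0" "lcoeff g (?res (e - q)) \<noteq> 0"
        by (auto simp: lc split: if_splits)
      then show "ext (?res q) = q" by (intro ext_res)
      show "?res q \<in> {p. lcoeff f p \<noteq> 0 \<and> lcoeff g (?res e - p) \<noteq> 0}"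
        using q(2,3) unfolding res_diff by simp
    qed
    finally show ?thesis by (simp add: times_laurent.rep_eq)
  next
    case False
    have "\<not> (lcoeff (lrename \<rho> f) p \<noteq> 0 \<and> lcoeff (lrename \<rho> g) (e - p) \<noteq> 0)" for p
    proof
      assume "lcoeff (lrename \<rho> f) p \<noteq> 0 \<and> lcoeff (lrename \<rho> g) (e - p) \<noteq> 0"
      then have "off p" "off (e - p)" by (auto simp: lc split: if_splits)
      then have "off e" by (simp add: off_def)
      with False show False by simp
    qed
    then have "lcoeff (lrename \<rho> f * lrename \<rho> g) e = 0"
      by (simp only: times_laurent.rep_eq conv_def) simp
    moreover have "lcoeff (lrename \<rho> (f * g)) e = 0"
      using False by (simp only: lc if_False)
    ultimately show ?thesis by simp
  qed
qed

lemma lrename_lrename: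
  fixes \<rho> :: "'a::finite \<Rightarrow> 'b::finite" and \<sigma> :: "'b \<Rightarrow> 'c::finite"
  assumes "inj \<sigma>"
  shows "lrename \<sigma> (lrename \<rho> f) = lrename (\<lambda>x. \<sigma> (\<rho> x)) f"
proof (rule laurent_eqI)
  fix e :: "int ^ 'c"
  have range: "y \<in> range (\<lambda>x. \<sigma> (\<rho> x)) \<longleftrightarrow> (\<exists>z. y = \<sigma> z \<and> z \<in> range \<rho>)" for y by auto
  have "(\<forall>y. y \<notin> range (\<lambda>x. \<sigma> (\<rho> x)) \<longrightarrow> e $ y = 0) \<longleftrightarrow>
    (\<forall>y. y \<notin> range \<sigma> \<longrightarrow> e $ y = 0) \<and> (\<forall>z. z \<notin> range \<rho> \<longrightarrow> e $ \<sigma> z = 0)" (is "?L \<longleftrightarrow> ?R")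
  proof
    assume ?L
    then show ?R unfolding range using assms by (auto simp: inj_eq)
  next
    assume ?R
    then show ?L unfolding range by (metis rangeE)
  qed
  then show "lcoeff (lrename \<sigma> (lrename \<rho> f)) e = lcoeff (lrename (\<lambda>x. \<sigma> (\<rho> x)) f) e"
    by (simp add: lrename.rep_eq del: not_all)
qed

lemma lpderiv_lrename:
  fixes \<rho> :: "'a::finite \<Rightarrow> 'b::finite"
  assumes "inj \<rho>"
  shows "lpderiv (\<rho> x) (lrename \<rho> f) = lrename \<rho> (lpderiv x f)"
proof (rule laurent_eqI)
  fix e :: "int ^ 'b"
  have "(\<chi> z. (e + axis (\<rho> x) 1) $ \<rho> z) = (\<chi> z. e $ \<rho> z) + axis x 1"
    using assms by (auto simp: vec_eq_iff axis_def inj_eq)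
  moreover have "(\<forall>y. y \<notin> range \<rho> \<longrightarrow> (e + axis (\<rho> x) 1) $ y = 0) \<longleftrightarrow>
      (\<forall>y. y \<notin> range \<rho> \<longrightarrow> e $ y = 0)"
  proof -
    have "(e + axis (\<rho> x) 1) $ y = e $ y" if "y \<notin> range \<rho>" for y
      using that by (auto simp: axis_def)
    then show ?thesis by simp
  qed
  ultimately show "lcoeff (lpderiv (\<rho> x) (lrename \<rho> f)) e = lcoeff (lrename \<rho> (lpderiv x f)) e"
    by (simp only: lpderiv.rep_eq lrename.rep_eq vec_lambda_beta) (simp del: not_all)
qed

lemma lpderiv_lrename_other:
  assumes "y \<notin> range \<rho>"
  shows "lpderiv y (lrename \<rho> f) = 0"
proof (rule laurent_eqI)
  fix e
  show "lcoeff (lpderiv y (lrename \<rho> f)) e = lcoeff 0 e"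
  \<comment> \<open>the factor \<open>e\<^sub>y + 1\<close> kills the only exponent that survives the shift\<close>
  proof (cases "e $ y + 1 = 0")
    case False
    then have "(e + axis y 1) $ y \<noteq> 0" by simp
    with assms have "lcoeff (lrename \<rho> f) (e + axis y 1) = 0"
      by (auto simp only: lrename.rep_eq if_False split: if_splits)
    then show ?thesis by (simp add: lpderiv.rep_eq zero_laurent.rep_eq)
  next
    case True
    then show ?thesis by (simp only: lpderiv.rep_eq zero_laurent.rep_eq of_int_0 mult_zero_left)
  qed
qed

section \<open>The Yang--Baxter equation for Laurent series\<close>

text \<open>
  The field \<open>\<Sum>k. \<partial>/\<partial>F\<^sup>k\<close>, given by its components \<open>e = J\<inverse> 1\<close> in the original coordinates.
\<close>

definition laurent_shift_field :: "'n::finite laurent ^ 'n \<Rightarrow> 'n \<Rightarrow> 'n laurent" where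
  "laurent_shift_field F i = (\<Sum>k\<in>UNIV. matrix_inv (laurent_jacobian F) $ i $ k)"

text \<open>
  The Euler field \<open>\<Sum>k. F\<^sup>k \<partial>/\<partial>F\<^sup>k\<close>, given by its components \<open>X = J\<inverse> F\<close> in the original coordinates.
\<close>

definition laurent_euler_field :: "'n::finite laurent ^ 'n \<Rightarrow> 'n \<Rightarrow> 'n laurent" where
  "laurent_euler_field F i = (\<Sum>k\<in>UNIV. matrix_inv (laurent_jacobian F) $ i $ k * F $ k)"

lemma laurent_shift_euler_bracket:
  assumes "invertible (laurent_jacobian F)"
  shows "(\<Sum>s\<in>UNIV. laurent_shift_field F s * lpderiv s (laurent_euler_field F i)
      - laurent_euler_field F s * lpderiv s (laurent_shift_field F i))
    = laurent_shift_field F i"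
proof (rule shift_euler_bracket)
  note inv = matrix_inv_of_invertible[OF assms]
  let ?J = "\<lambda>a i. lpderiv i (F $ a)"
  have J: "laurent_jacobian F $ a $ i = ?J a i" for a i by (simp add: laurent_jacobian_def)
  show "(\<Sum>a\<in>UNIV. matrix_inv (laurent_jacobian F) $ i $ a * ?J a j) = (if i = j then 1 else 0)" for i j
    using inv(2) by (simp add: matrix_mult_eq_one_iff J)
  show "lpderiv s (?J a i) = lpderiv i (?J a s)" for s a i by (rule lpderiv_commute)
  show Je: "(\<Sum>i\<in>UNIV. ?J a i * laurent_shift_field F i) = 1" for a
    using right_inverse_apply[OF inv(1), of a "\<lambda>_. 1"] by (simp add: J laurent_shift_field_def)
  have JX: "(\<Sum>i\<in>UNIV. ?J a i * laurent_euler_field F i) = F $ a" for a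
    using right_inverse_apply[OF inv(1), of a "\<lambda>k. F $ k"] by (simp add: J laurent_euler_field_def)
  show "(\<Sum>i\<in>UNIV. lpderiv s (?J a i) * laurent_shift_field F i
      + ?J a i * lpderiv s (laurent_shift_field F i)) = 0"
      for a s
    using arg_cong[OF Je[of a], of "lpderiv s"] by (simp add: lpderiv_sum lpderiv_mult)
  show "(\<Sum>i\<in>UNIV. lpderiv s (?J a i) * laurent_euler_field F i
      + ?J a i * lpderiv s (laurent_euler_field F i)) = ?J a s"
      for a s
    using arg_cong[OF JX[of a], of "lpderiv s"] by (simp add: lpderiv_sum lpderiv_mult)
qed

lemma laurent_phi_wedge:
  "laurent_phi F i j = lrename Inl (laurent_euler_field F i) * lrename Inr (laurent_shift_field F j)
     - lrename Inl (laurent_shift_field F i) * lrename Inr (laurent_euler_field F j)"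
proof -
  have [simp]: "lrename Inl (f * g) = lrename Inl f * lrename Inl g"
    "lrename Inr (f * g) = lrename Inr f * lrename Inr g" for f g :: "'a laurent"
    by (simp_all add: lrename_mult)
  let ?G = "matrix_inv (laurent_jacobian F)"
  have "laurent_phi F i j
      = (\<Sum>k\<in>UNIV. \<Sum>l\<in>UNIV. lrename Inl (?G $ i $ k * F $ k) * lrename Inr (?G $ j $ l))
      - (\<Sum>k\<in>UNIV. \<Sum>l\<in>UNIV. lrename Inl (?G $ i $ k) * lrename Inr (?G $ j $ l * F $ l))"
    unfolding laurent_phi_def sum_subtractf[symmetric]
    by (intro sum.cong refl) (simp add: algebra_simps)
  then show ?thesis
    by (simp add: laurent_euler_field_def laurent_shift_field_def lrename_sum sum_product)
qed

lemma inj_case_sum: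
  assumes "inj x" "inj y" "range x \<inter> range y = {}"
  shows "inj (case_sum x y)"
proof (rule injI)
  fix a b assume "case_sum x y a = case_sum x y b"
  then show "a = b"
    using assms by (cases a; cases b) (auto simp: inj_eq)
qed

lemma at_vars_laurent_phi:
  assumes "inj (case_sum x y)"
  shows "at_vars (laurent_phi F i j) x y
      = lrename x (laurent_euler_field F i) * lrename y (laurent_shift_field F j)
     - lrename x (laurent_shift_field F i) * lrename y (laurent_euler_field F j)"
  using assms
  by (simp add: at_vars_def laurent_phi_wedge lrename_diff lrename_mult lrename_lrename)

lemma lpderiv_at_vars_laurent_phi:
  assumes "inj (case_sum x y)"
  shows "lpderiv (x s) (at_vars (laurent_phi F i j) x y)
     = lrename x (lpderiv s (laurent_euler_field F i)) * lrename y (laurent_shift_field F j)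
     - lrename x (lpderiv s (laurent_shift_field F i)) * lrename y (laurent_euler_field F j)"
proof -
  have "inj x"
  proof (rule injI)
    fix a b assume "x a = x b"
    then have "case_sum x y (Inl a) = case_sum x y (Inl b)" by simp
    with assms show "a = b" by (blast dest: injD)
  qed
  moreover have "x s \<notin> range y"
  proof
    assume "x s \<in> range y"
    then obtain t where "case_sum x y (Inl s) = case_sum x y (Inr t)" by auto
    with assms show False by (blast dest: injD)
  qed
  ultimately show ?thesis
    using assms
        by (simp add: at_vars_laurent_phi lpderiv_diff lpderiv_mult lpderiv_lrename lpderiv_lrename_other)
qed

lemma laurent_skew_phi: "laurent_skew (laurent_phi F)"
proof -
  have "inj (case_sum Inl Inr :: 'a + 'a \<Rightarrow> 'a + 'a)" "inj (case_sum Inr Inl :: 'a + 'a \<Rightarrow> 'a + 'a)"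
    by (auto simp: inj_def split: sum.splits)
  then show ?thesis by (simp add: laurent_skew_def at_vars_laurent_phi mult.commute)
qed

lemma laurent_CYBE_phi:
  fixes F :: "'n::finite laurent ^ 'n"
  assumes "invertible (laurent_jacobian F)"
  shows "laurent_CYBE_solution (laurent_phi F)"
proof -
  have inj_vars: "inj (var_u :: 'n \<Rightarrow> _)" "inj (var_v :: 'n \<Rightarrow> _)" "inj (var_w :: 'n \<Rightarrow> _)"
    by (auto simp: inj_def)
  have inj: "inj (case_sum var_u var_v :: 'n + 'n \<Rightarrow> _)" "inj (case_sum var_v var_u :: 'n + 'n \<Rightarrow> _)"
    "inj (case_sum var_v var_w :: 'n + 'n \<Rightarrow> _)" "inj (case_sum var_w var_v :: 'n + 'n \<Rightarrow> _)"
    "inj (case_sum var_w var_u :: 'n + 'n \<Rightarrow> _)" "inj (case_sum var_u var_w :: 'n + 'n \<Rightarrow> _)"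
    by (rule inj_case_sum; auto simp: inj_def)+
  have bracket: "(\<Sum>s\<in>UNIV. lrename x (laurent_shift_field F s) * lrename x (lpderiv s (laurent_euler_field F i))
      - lrename x (laurent_euler_field F s) * lrename x (lpderiv s (laurent_shift_field F i)))
          = lrename x (laurent_shift_field F i)"
    if "inj x" for x :: "'n \<Rightarrow> 'n + 'n + 'n" and i
    using arg_cong[OF laurent_shift_euler_bracket[OF assms, of i], of "lrename x"] that
    by (simp add: lrename_sum lrename_diff lrename_mult)
  note br = inj_vars[THEN bracket]
  show ?thesis
    unfolding laurent_CYBE_solution_def
  proof (intro conjI allI)
    show "laurent_skew (laurent_phi F)" by (rule laurent_skew_phi)
  next
    fix i j k
    show "(\<Sum>s\<in>UNIV.
          at_vars (laurent_phi F k s) var_w var_u * lpderiv (var_u s) (at_vars (laurent_phi F i j) var_u var_v)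
        + at_vars (laurent_phi F s k) var_v var_w * lpderiv (var_v s) (at_vars (laurent_phi F j i) var_v var_u)
        + at_vars (laurent_phi F i s) var_u var_v * lpderiv (var_v s) (at_vars (laurent_phi F j k) var_v var_w)
        + at_vars (laurent_phi F s i) var_w var_u * lpderiv (var_w s) (at_vars (laurent_phi F k j) var_w var_v)
        + at_vars (laurent_phi F j s) var_v var_w * lpderiv (var_w s) (at_vars (laurent_phi F k i) var_w var_u)
        + at_vars (laurent_phi F s j) var_u var_v * lpderiv (var_u s) (at_vars (laurent_phi F i k) var_u var_w)) = 0"
      unfolding lpderiv_at_vars_laurent_phi[OF inj(1)] lpderiv_at_vars_laurent_phi[OF inj(2)]
       lpderiv_at_vars_laurent_phi[OF inj(3)] lpderiv_at_vars_laurent_phi[OF inj(4)]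
       lpderiv_at_vars_laurent_phi[OF inj(5)] lpderiv_at_vars_laurent_phi[OF inj(6)]
      unfolding at_vars_laurent_phi[OF inj(1)] at_vars_laurent_phi[OF inj(3)] at_vars_laurent_phi[OF inj(5)]
      by (rule wedge_solves_CYBE; rule br)
  qed
qed

section \<open>Commutation of mixed second derivatives\<close>

lemma has_derivative_along_line:
  fixes f :: "'a::real_normed_vector \<Rightarrow> real"
  assumes "f differentiable (at (y + t *\<^sub>R a))"
  shows "((\<lambda>t. f (y + t *\<^sub>R a)) has_derivative
    (\<lambda>h. h * frechet_derivative f (at (y + t *\<^sub>R a)) a)) (at t)"
proof -
  have "((\<lambda>t. f (y + t *\<^sub>R a)) has_derivative
      (\<lambda>h. frechet_derivative f (at (y + t *\<^sub>R a)) (h *\<^sub>R a))) (at t)"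
    by (rule has_derivative_compose[of "\<lambda>t. y + t *\<^sub>R a"])
      (auto intro!: derivative_eq_intros frechet_derivative_works[THEN iffD1] assms)
  then show ?thesis
    using linear_cmul[OF linear_frechet_derivative[OF assms]] by simp
qed

text \<open>
  The mean value theorem, applied first in the direction \<open>a\<close> and then in the direction \<open>b\<close>. The left-hand
  side of the equation is symmetric in \<open>a\<close> and \<open>b\<close>, which yields the commutation of mixed derivatives.
\<close>

lemma second_difference_mean_value:
  fixes f :: "'a::real_normed_vector \<Rightarrow> real"
  assumes f: "\<And>x. f differentiable (at x)"
    and fa: "\<And>x. (\<lambda>x. frechet_derivative f (at x) a) differentiable (at x)"
    and h: "h > 0"
  obtains \<xi> \<eta> where "0 < \<xi>" "\<xi> < h" "0 < \<eta>" "\<eta> < h"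
    "f (x + h *\<^sub>R a + h *\<^sub>R b) - f (x + h *\<^sub>R a) - f (x + h *\<^sub>R b) + f x
      = h * h * frechet_derivative (\<lambda>x. frechet_derivative f (at x) a) (at (x + \<xi> *\<^sub>R a + \<eta> *\<^sub>R b)) b"
proof -
  let ?fa = "\<lambda>x. frechet_derivative f (at x) a"
  define g where "g t = f ((x + h *\<^sub>R b) + t *\<^sub>R a) - f (x + t *\<^sub>R a)" for t
  have g': "(g has_derivative
      (\<lambda>k. k * ?fa ((x + h *\<^sub>R b) + t *\<^sub>R a) - k * ?fa (x + t *\<^sub>R a))) (at t)" for t
    unfolding g_def by (intro has_derivative_diff has_derivative_along_line f)
  then have "continuous_on {0..h} g"
    by (meson continuous_at_imp_continuous_on has_derivative_continuous)
  from mvt[OF h this g'] obtain \<xi> where \<xi>: "0 < \<xi>" "\<xi> < h" and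
    1: "g h - g 0 = (h - 0) * ?fa ((x + h *\<^sub>R b) + \<xi> *\<^sub>R a) - (h - 0) * ?fa (x + \<xi> *\<^sub>R a)" by auto
  define q where "q t = ?fa ((x + \<xi> *\<^sub>R a) + t *\<^sub>R b)" for t
  have q': "(q has_derivative
      (\<lambda>k. k * frechet_derivative ?fa (at ((x + \<xi> *\<^sub>R a) + t *\<^sub>R b)) b)) (at t)" for t
    unfolding q_def by (rule has_derivative_along_line[OF fa])
  then have "continuous_on {0..h} q"
    by (meson continuous_at_imp_continuous_on has_derivative_continuous)
  from mvt[OF h this q'] obtain \<eta> where \<eta>: "0 < \<eta>" "\<eta> < h" and
    2: "q h - q 0 = (h - 0) * frechet_derivative ?fa (at ((x + \<xi> *\<^sub>R a) + \<eta> *\<^sub>R b)) b" by auto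
  have "g h - g 0 = h * (q h - q 0)"
    unfolding 1 q_def by (simp add: algebra_simps)
  also have "\<dots> = h * h * frechet_derivative ?fa (at (x + \<xi> *\<^sub>R a + \<eta> *\<^sub>R b)) b"
    unfolding 2 by simp
  finally have "f (x + h *\<^sub>R a + h *\<^sub>R b) - f (x + h *\<^sub>R a) - f (x + h *\<^sub>R b) + f x
      = h * h * frechet_derivative ?fa (at (x + \<xi> *\<^sub>R a + \<eta> *\<^sub>R b)) b"
    by (simp add: g_def algebra_simps)
  with \<xi> \<eta> show ?thesis by (rule that)
qed

lemma second_derivative_as_limit:
  fixes f :: "'a::real_normed_vector \<Rightarrow> real"
  assumes f: "\<And>x. f differentiable (at x)"
    and fa: "\<And>x. (\<lambda>x. frechet_derivative f (at x) a) differentiable (at x)"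
    and cont: "isCont (\<lambda>x. frechet_derivative (\<lambda>x. frechet_derivative f (at x) a) (at x) b) x"
  shows "(\<lambda>n. let h = inverse (real (Suc n)) in
      (f (x + h *\<^sub>R a + h *\<^sub>R b) - f (x + h *\<^sub>R a) - f (x + h *\<^sub>R b) + f x) / (h * h))
    \<longlonglongrightarrow> frechet_derivative (\<lambda>x. frechet_derivative f (at x) a) (at x) b"
proof -
  let ?D = "\<lambda>x. frechet_derivative (\<lambda>x. frechet_derivative f (at x) a) (at x) b"
  define h where "h n = inverse (real (Suc n))" for n
  have h: "h n > 0" for n by (simp add: h_def)
  have h0: "h \<longlonglongrightarrow> 0" unfolding h_def by (rule LIMSEQ_inverse_real_of_nat)
  define Q where "Q n = f (x + h n *\<^sub>R a + h n *\<^sub>R b) - f (x + h n *\<^sub>R a) - f (x + h n *\<^sub>R b) + f x" for n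
  have "\<exists>\<xi> \<eta>. 0 < \<xi> \<and> \<xi> < h n \<and> 0 < \<eta> \<and> \<eta> < h n \<and> Q n = h n * h n * ?D (x + \<xi> *\<^sub>R a + \<eta> *\<^sub>R b)" for n
    using second_difference_mean_value[OF f fa h[of n], of x b] unfolding Q_def by metis
  then obtain \<xi> \<eta> where \<xi>\<eta>: "\<And>n. 0 < \<xi> n" "\<And>n. \<xi> n < h n" "\<And>n. 0 < \<eta> n" "\<And>n. \<eta> n < h n"
    and Q: "\<And>n. Q n = h n * h n * ?D (x + \<xi> n *\<^sub>R a + \<eta> n *\<^sub>R b)"
    by metis
  have "\<xi> \<longlonglongrightarrow> 0" "\<eta> \<longlonglongrightarrow> 0"
    using \<xi>\<eta> by (auto intro!: tendsto_sandwich[OF _ _ tendsto_const h0] always_eventually less_imp_le)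
  then have "(\<lambda>n. x + \<xi> n *\<^sub>R a + \<eta> n *\<^sub>R b) \<longlonglongrightarrow> x + 0 *\<^sub>R a + 0 *\<^sub>R b"
    by (intro tendsto_intros)
  then have "(\<lambda>n. ?D (x + \<xi> n *\<^sub>R a + \<eta> n *\<^sub>R b)) \<longlonglongrightarrow> ?D x"
    by (intro isCont_tendsto_compose[OF cont]) simp
  moreover have "?D (x + \<xi> n *\<^sub>R a + \<eta> n *\<^sub>R b) = Q n / (h n * h n)" for n
    using h[of n] by (simp add: Q)
  ultimately show ?thesis by (simp add: Q_def h_def Let_def)
qed

lemma second_derivatives_commute:
  fixes f :: "'a::real_normed_vector \<Rightarrow> real"
  assumes f: "\<And>x. f differentiable (at x)"
    and fa: "\<And>x. (\<lambda>x. frechet_derivative f (at x) a) differentiable (at x)"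
    and fb: "\<And>x. (\<lambda>x. frechet_derivative f (at x) b) differentiable (at x)"
    and "isCont (\<lambda>x. frechet_derivative (\<lambda>x. frechet_derivative f (at x) a) (at x) b) x"
    and "isCont (\<lambda>x. frechet_derivative (\<lambda>x. frechet_derivative f (at x) b) (at x) a) x"
  shows "frechet_derivative (\<lambda>x. frechet_derivative f (at x) a) (at x) b
    = frechet_derivative (\<lambda>x. frechet_derivative f (at x) b) (at x) a"
proof -
  let ?q = "\<lambda>a b n. let h = inverse (real (Suc n)) in
      (f (x + h *\<^sub>R a + h *\<^sub>R b) - f (x + h *\<^sub>R a) - f (x + h *\<^sub>R b) + f x) / (h * h)"
  have "?q a b = ?q b a" by (simp add: Let_def algebra_simps)
  then show ?thesis
    using LIMSEQ_unique[OF second_derivative_as_limit[OF f fa assms(4)]]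
      second_derivative_as_limit[OF f fb assms(5)] by simp
qed

section \<open>Calculus of smooth functions\<close>

lemma C_k_SucD: "C_k (Suc k) f \<Longrightarrow> C_k k f"
proof (induction k arbitrary: f)
  case 0
  then show ?case
    by (auto intro!: continuous_at_imp_continuous_on differentiable_imp_continuous_within)
next
  case (Suc k)
  then have "\<And>x. f differentiable (at x)" "\<And>b. b \<in> Basis \<Longrightarrow> C_k (Suc k) (\<lambda>x. frechet_derivative f (at x) b)"
    by simp_all
  with Suc.IH show ?case by simp
qed

lemma C_k_const: "C_k k (\<lambda>x. c)"
  by (induction k arbitrary: c) simp_all

lemma C_k_bounded_linear:
  assumes "bounded_linear L" "C_k k f"
  shows "C_k k (\<lambda>x. L (f x))"
  using assms(2)
proof (induction k arbitrary: f)
  case 0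
  then show ?case by (simp add: bounded_linear.continuous_on[OF assms(1)])
next
  case (Suc k)
  then have f: "\<And>x. f differentiable (at x)" by simp
  have d: "((\<lambda>x. L (f x)) has_derivative (\<lambda>h. L (frechet_derivative f (at x) h))) (at x)" for x
    using f[of x] by (intro bounded_linear.has_derivative[OF assms(1)]) (simp add: frechet_derivative_works)
  have eq: "frechet_derivative (\<lambda>x. L (f x)) (at x) = (\<lambda>h. L (frechet_derivative f (at x) h))" for x
    by (rule frechet_derivative_at[OF d, symmetric])
  show ?case
    using Suc d unfolding C_k.simps eq by (auto simp: differentiable_def)
qed

text \<open>
  The condition on basis vectors holds for the projections \<open>fst\<close> and \<open>snd\<close>. It is imposed because \<open>C_k\<close>
  speaks of derivatives in basis directions only.
\<close>

lemma C_k_compose_linear: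
  assumes L: "bounded_linear L" and Basis: "\<And>b. b \<in> Basis \<Longrightarrow> L b \<in> Basis \<or> L b = 0"
    and "C_k k f"
  shows "C_k k (\<lambda>x. f (L x))"
  using assms(3)
proof (induction k arbitrary: f)
  case 0
  then show ?case
    using continuous_on_compose2[of UNIV f UNIV L] bounded_linear.continuous_on[OF L continuous_on_id]
    by simp
next
  case (Suc k)
  then have f: "\<And>x. f differentiable (at x)" by simp
  have d: "((\<lambda>x. f (L x)) has_derivative (\<lambda>h. frechet_derivative f (at (L x)) (L h))) (at x)" for x
    using f[of "L x"]
    by (intro has_derivative_compose[OF bounded_linear_imp_has_derivative[OF L]])
      (simp add: frechet_derivative_works)
  have eq: "frechet_derivative (\<lambda>x. f (L x)) (at x) = (\<lambda>h. frechet_derivative f (at (L x)) (L h))" for x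
    by (rule frechet_derivative_at[OF d, symmetric])
  have "C_k k (\<lambda>x. frechet_derivative f (at (L x)) (L b))" if "b \<in> Basis" for b
    using Basis[OF that]
  proof
    assume "L b \<in> Basis"
    then have "C_k k (\<lambda>x. frechet_derivative f (at x) (L b))" using Suc.prems by simp
    then show ?thesis by (rule Suc.IH)
  next
    assume "L b = 0"
    then show ?thesis
      using linear_0[OF linear_frechet_derivative[OF f]] by (simp add: C_k_const)
  qed
  then show ?case
    using d unfolding C_k.simps eq by (auto simp: differentiable_def)
qed

lemma C_k_add:
  assumes "C_k k f" "C_k k g"
  shows "C_k k (\<lambda>x. f x + g x)"
  using assms
proof (induction k arbitrary: f g)
  case 0
  then show ?case by (simp add: continuous_on_add)
next
  case (Suc k)
  then have fg: "\<And>x. f differentiable (at x)" "\<And>x. g differentiable (at x)" by simp_all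
  have d: "((\<lambda>x. f x + g x) has_derivative
      (\<lambda>h. frechet_derivative f (at x) h + frechet_derivative g (at x) h)) (at x)" for x
    using fg by (intro has_derivative_add) (simp_all add: frechet_derivative_works)
  have eq: "frechet_derivative (\<lambda>x. f x + g x) (at x)
      = (\<lambda>h. frechet_derivative f (at x) h + frechet_derivative g (at x) h)" for x
    by (rule frechet_derivative_at[OF d, symmetric])
  show ?case
    using Suc d unfolding C_k.simps eq by (auto simp: differentiable_def)
qed

lemma C_k_mult:
  fixes f g :: "'a::euclidean_space \<Rightarrow> real"
  assumes "C_k k f" "C_k k g"
  shows "C_k k (\<lambda>x. f x * g x)"
  using assms
proof (induction k arbitrary: f g)
  case 0
  then show ?case by (simp add: continuous_on_mult)
next
  case (Suc k)
  then have fg: "\<And>x. f differentiable (at x)" "\<And>x. g differentiable (at x)" by simp_all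
  have d: "((\<lambda>x. f x * g x) has_derivative
      (\<lambda>h. f x * frechet_derivative g (at x) h + frechet_derivative f (at x) h * g x)) (at x)" for x
    using fg by (intro has_derivative_mult) (simp_all add: frechet_derivative_works)
  have eq: "frechet_derivative (\<lambda>x. f x * g x) (at x)
      = (\<lambda>h. f x * frechet_derivative g (at x) h + frechet_derivative f (at x) h * g x)" for x
    by (rule frechet_derivative_at[OF d, symmetric])
  have "C_k k f" "C_k k g" using Suc.prems by (blast intro: C_k_SucD)+
  then have "C_k k (\<lambda>x. f x * frechet_derivative g (at x) b + frechet_derivative f (at x) b * g x)"
    if "b \<in> Basis" for b
    using Suc.prems that by (intro C_k_add Suc.IH) simp_all
  then show ?case
    using d unfolding C_k.simps eq by (auto simp: differentiable_def)
qed

lemma C_k_uminus: "C_k k f \<Longrightarrow> C_k k (\<lambda>x. - f x)"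
  by (rule C_k_bounded_linear[OF bounded_linear_minus[OF bounded_linear_ident]])

lemma C_k_diff: "C_k k f \<Longrightarrow> C_k k g \<Longrightarrow> C_k k (\<lambda>x. f x - g x)"
  using C_k_add[OF _ C_k_uminus, of k f g] by simp

lemma C_k_sum: "(\<And>i. i \<in> A \<Longrightarrow> C_k k (f i)) \<Longrightarrow> C_k k (\<lambda>x. \<Sum>i\<in>A. f i x)"
  by (induction A rule: infinite_finite_induct) (auto intro: C_k_const C_k_add)

lemmas C_k_intros = C_k_const C_k_add C_k_mult C_k_uminus C_k_diff C_k_sum

lemma smooth_differentiable: "smooth f \<Longrightarrow> f differentiable (at x)"
  unfolding smooth_def by (metis C_k.simps(2))

lemma smooth_continuous: "smooth f \<Longrightarrow> isCont f x"
  by (rule differentiable_imp_continuous_within[OF smooth_differentiable])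

lemma smooth_frechet_derivative:
  "smooth f \<Longrightarrow> b \<in> Basis \<Longrightarrow> smooth (\<lambda>x. frechet_derivative f (at x) b)"
  unfolding smooth_def by (metis C_k.simps(2))

lemma smooth_vec_nth: "smooth f \<Longrightarrow> smooth (\<lambda>x. f x $ a)"
  unfolding smooth_def using C_k_bounded_linear[OF bounded_linear_vec_nth] by blast

lemma smooth_fst_snd_times:
  fixes f :: "'a::euclidean_space \<Rightarrow> real" and g :: "'b::euclidean_space \<Rightarrow> real"
  assumes "smooth f" "smooth g"
  shows "smooth (\<lambda>p. f (fst p) * g (snd p))"
  using assms unfolding smooth_def
  by (auto intro!: C_k_mult C_k_compose_linear[OF bounded_linear_fst] C_k_compose_linear[OF bounded_linear_snd]
      simp: Basis_prod_def)

lemma pderiv_at_const: "pderiv_at s (\<lambda>x. c) x = 0"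
  by (simp add: pderiv_at_def)

lemma pderiv_at_mult:
  assumes "f differentiable (at x)" "g differentiable (at x)"
  shows "pderiv_at s (\<lambda>x. f x * g x) x = pderiv_at s f x * g x + f x * pderiv_at s g x"
proof -
  have "((\<lambda>x. f x * g x) has_derivative
      (\<lambda>h. f x * frechet_derivative g (at x) h + frechet_derivative f (at x) h * g x)) (at x)"
    using assms by (intro has_derivative_mult) (simp_all add: frechet_derivative_works)
  from frechet_derivative_at[OF this, symmetric] show ?thesis by (simp add: pderiv_at_def)
qed

lemma pderiv_at_sum:
  assumes "\<And>i. i \<in> A \<Longrightarrow> f i differentiable (at x)"
  shows "pderiv_at s (\<lambda>x. \<Sum>i\<in>A. f i x) x = (\<Sum>i\<in>A. pderiv_at s (f i) x)"
proof -
  have "((\<lambda>x. \<Sum>i\<in>A. f i x) has_derivative (\<lambda>h. \<Sum>i\<in>A. frechet_derivative (f i) (at x) h)) (at x)"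
    using assms by (intro has_derivative_sum) (simp_all add: frechet_derivative_works)
  from frechet_derivative_at[OF this, symmetric] show ?thesis by (simp add: pderiv_at_def)
qed

lemma pderiv_at_sum_mult:
  assumes "\<And>i. f i differentiable (at x)" "\<And>i. g i differentiable (at x)"
  shows "pderiv_at s (\<lambda>x. \<Sum>i\<in>UNIV. f i x * g i x) x
    = (\<Sum>i\<in>UNIV. pderiv_at s (f i) x * g i x + f i x * pderiv_at s (g i) x)"
  using assms by (subst pderiv_at_sum) (auto simp: pderiv_at_mult intro!: differentiable_mult)

lemma pderiv_at_combination:
  assumes "f differentiable (at x)" "g differentiable (at x)"
  shows "pderiv_at s (\<lambda>x. f x * c - g x * d) x = pderiv_at s f x * c - pderiv_at s g x * d"
proof -
  have "((\<lambda>x. f x * c - g x * d) has_derivative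
      (\<lambda>h. frechet_derivative f (at x) h * c - frechet_derivative g (at x) h * d)) (at x)"
    using assms
    by (intro has_derivative_diff has_derivative_mult_left) (simp_all add: frechet_derivative_works)
  from frechet_derivative_at[OF this, symmetric] show ?thesis by (simp add: pderiv_at_def)
qed

lemma smooth_pderiv_at: "smooth f \<Longrightarrow> smooth (pderiv_at s f)"
  using smooth_frechet_derivative[of f "axis s 1"] by (simp add: pderiv_at_def[abs_def] axis_in_Basis_iff)

lemma pderiv_at_commute:
  assumes "smooth f"
  shows "pderiv_at s (pderiv_at t f) x = pderiv_at t (pderiv_at s f) x"
proof -
  have 1: "smooth (\<lambda>x. frechet_derivative f (at x) (axis r 1))" for r
    using smooth_pderiv_at[OF assms] by (simp add: pderiv_at_def[abs_def])
  have 2: "smooth (\<lambda>x. frechet_derivative (\<lambda>x. frechet_derivative f (at x) (axis r 1)) (at x) (axis q 1))" for r q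
    using smooth_pderiv_at[OF 1] by (simp add: pderiv_at_def[abs_def])
  show ?thesis
    unfolding pderiv_at_def[abs_def]
    by (intro second_derivatives_commute smooth_differentiable smooth_continuous assms 1 2)
qed

lemma jacobian_nth:
  assumes "F differentiable (at u)"
  shows "jacobian F (at u) $ a $ i = pderiv_at i (\<lambda>u. F u $ a) u"
proof -
  have "((\<lambda>u. F u $ a) has_derivative (\<lambda>h. frechet_derivative F (at u) h $ a)) (at u)"
    using assms by (intro bounded_linear.has_derivative[OF bounded_linear_vec_nth])
      (simp add: frechet_derivative_works)
  from frechet_derivative_at[OF this, symmetric] show ?thesis
    by (simp add: pderiv_at_def jacobian_def matrix_def)
qed

lemma matrix_inv_jacobian_diffeomorphism:
  fixes F :: "real ^ 'n \<Rightarrow> real ^ 'n"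
  assumes F: "diffeomorphism F" and inv: "invertible (jacobian F (at u))"
  shows "matrix_inv (jacobian F (at u)) = jacobian (inv F) (at (F u))"
proof -
  let ?A = "jacobian F (at u)" and ?B = "jacobian (inv F) (at (F u))"
  have d: "F differentiable (at u)" "inv F differentiable (at (F u))"
    using F by (auto simp: diffeomorphism_def intro: smooth_differentiable)
  have "inv F \<circ> F = id" using F by (simp add: diffeomorphism_def bij_is_inj)
  then have "frechet_derivative (inv F) (at (F u)) \<circ> frechet_derivative F (at u) = id"
    using frechet_derivative_compose[OF d] by simp
  then have "?B ** ?A = mat 1"
    unfolding jacobian_def
    by (simp add: matrix_compose[symmetric] linear_frechet_derivative d matrix_id_mat_1)
  then have "?B = ?B ** ?A ** matrix_inv ?A"
    using matrix_inv_of_invertible(1)[OF inv] by (metis matrix_mul_assoc matrix_mul_rid)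
  with \<open>?B ** ?A = mat 1\<close> show ?thesis by simp
qed

section \<open>The Yang--Baxter equation for a diffeomorphism\<close>

context
  fixes F :: "real ^ 'n \<Rightarrow> real ^ 'n"
  assumes diffeo: "diffeomorphism F" and invert: "\<And>u. invertible (jacobian F (at u))"
begin

text \<open>The entry \<open>\<partial>\<^sub>i F\<^sup>a\<close> of the Jacobian matrix, as a function of the point.\<close>

definition jacobian_entry :: "'n \<Rightarrow> 'n \<Rightarrow> real ^ 'n \<Rightarrow> real" where
  "jacobian_entry a i = pderiv_at i (\<lambda>u. F u $ a)"

text \<open>The entries of the inverse Jacobian matrix.\<close>

definition inverse_entry :: "'n \<Rightarrow> 'n \<Rightarrow> real ^ 'n \<Rightarrow> real" where
  "inverse_entry i k u = matrix_inv (jacobian F (at u)) $ i $ k"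

text \<open>The components \<open>e = J\<inverse> 1\<close> of the field \<open>\<Sum>k. \<partial>/\<partial>F\<^sup>k\<close>.\<close>

definition shift_field :: "'n \<Rightarrow> real ^ 'n \<Rightarrow> real" where
  "shift_field i u = (\<Sum>k\<in>UNIV. inverse_entry i k u)"

text \<open>The components \<open>X = J\<inverse> F\<close> of the Euler field \<open>\<Sum>k. F\<^sup>k \<partial>/\<partial>F\<^sup>k\<close>.\<close>

definition euler_field :: "'n \<Rightarrow> real ^ 'n \<Rightarrow> real" where
  "euler_field i u = (\<Sum>k\<in>UNIV. inverse_entry i k u * F u $ k)"

lemma smooth_component: "smooth (\<lambda>u. F u $ a)"
  using diffeo by (simp add: diffeomorphism_def smooth_vec_nth)

lemma differentiable_map: "F differentiable (at u)"
  using diffeo by (simp add: diffeomorphism_def smooth_differentiable)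

lemma smooth_jacobian_entry: "smooth (jacobian_entry a i)"
  unfolding jacobian_entry_def by (intro smooth_pderiv_at smooth_component)

lemma jacobian_eq_entry: "jacobian F (at u) $ a $ i = jacobian_entry a i u"
  by (simp add: jacobian_entry_def jacobian_nth[OF differentiable_map])

lemma entry_inverse_entry: "(\<Sum>b\<in>UNIV. jacobian_entry a b u * inverse_entry b k u) = (if a = k then 1 else 0)"
  using matrix_inv_of_invertible(1)[OF invert[of u]]
  by (simp add: matrix_mult_eq_one_iff jacobian_eq_entry inverse_entry_def)

lemma inverse_entry_entry: "(\<Sum>a\<in>UNIV. inverse_entry i a u * jacobian_entry a j u) = (if i = j then 1 else 0)"
  using matrix_inv_of_invertible(2)[OF invert[of u]]
  by (simp add: matrix_mult_eq_one_iff jacobian_eq_entry inverse_entry_def)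

text \<open>
  The entries of \<open>J\<inverse>\<close> are entries of the Jacobian of the smooth inverse map, evaluated at \<open>F u\<close>.
\<close>

lemma differentiable_inverse_entry: "inverse_entry i k differentiable (at u)"
proof -
  let ?h = "\<lambda>y. jacobian (inv F) (at y) $ i $ k"
  have sm: "smooth (inv F)" using diffeo by (simp add: diffeomorphism_def)
  have "?h = pderiv_at k (\<lambda>y. inv F y $ i)"
    by (rule ext, rule jacobian_nth, rule smooth_differentiable[OF sm])
  then have "smooth ?h" by (simp add: smooth_pderiv_at smooth_vec_nth sm)
  moreover have "inverse_entry i k = ?h \<circ> F"
    by (rule ext) (simp add: inverse_entry_def matrix_inv_jacobian_diffeomorphism[OF diffeo invert])
  ultimately show ?thesis
    using differentiable_chain_at[OF differentiable_map smooth_differentiable] by metis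
qed

text \<open>
  Differentiation of \<open>J J\<inverse> = 1\<close> gives \<open>\<partial>J\<inverse> = - J\<inverse> (\<partial>J) J\<inverse>\<close>.
\<close>

lemma pderiv_inverse_entry:
  "pderiv_at s (inverse_entry i k) u
    = - (\<Sum>a\<in>UNIV. \<Sum>b\<in>UNIV. inverse_entry i a u * pderiv_at s (jacobian_entry a b) u * inverse_entry b k u)"
proof -
  have "(\<Sum>b\<in>UNIV. pderiv_at s (jacobian_entry a b) u * inverse_entry b k u
      + jacobian_entry a b u * pderiv_at s (inverse_entry b k) u)
      = 0" for a
    using pderiv_at_sum_mult[of "jacobian_entry a" u "\<lambda>b. inverse_entry b k" s]
    by (simp add: entry_inverse_entry smooth_differentiable[OF smooth_jacobian_entry]
        differentiable_inverse_entry pderiv_at_const)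
  then have 1: "(\<Sum>b\<in>UNIV. jacobian_entry a b u * pderiv_at s (inverse_entry b k) u)
      = - (\<Sum>b\<in>UNIV. pderiv_at s (jacobian_entry a b) u * inverse_entry b k u)" for a
    by (simp add: sum.distrib eq_neg_iff_add_eq_0 add.commute)
  have "pderiv_at s (inverse_entry i k) u
      = (\<Sum>b\<in>UNIV. (\<Sum>a\<in>UNIV. inverse_entry i a u * jacobian_entry a b u) * pderiv_at s (inverse_entry b k) u)"
    by (simp add: inverse_entry_entry mult_if_delta)
  also have "\<dots> = (\<Sum>a\<in>UNIV. inverse_entry i a u
      * (\<Sum>b\<in>UNIV. jacobian_entry a b u * pderiv_at s (inverse_entry b k) u))"
    unfolding sum_distrib_left sum_distrib_right by (subst sum.swap) (simp add: mult.assoc)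
  finally show ?thesis
    unfolding 1 by (simp add: sum_distrib_left sum_negf mult.assoc)
qed

lemma smooth_inverse_entry: "smooth (inverse_entry i k)"
proof -
  have "\<forall>i j. C_k k (inverse_entry i j)" for k
  proof (induction k)
    case 0
    show ?case
      by (auto intro!: continuous_at_imp_continuous_on differentiable_imp_continuous_within
          differentiable_inverse_entry)
  next
    case (Suc k)
    have J: "C_k k (pderiv_at s (jacobian_entry a b))" for s a b
      using smooth_pderiv_at[OF smooth_jacobian_entry] by (simp add: smooth_def)
    \<comment> \<open>\<open>\<partial>J\<inverse>\<close> is a polynomial in entries of \<open>J\<inverse>\<close>, which are \<open>C\<^sup>k\<close> by induction, and of \<open>\<partial>J\<close>\<close>
    have "C_k k (\<lambda>u. frechet_derivative (inverse_entry i j) (at u) d)" if "d \<in> Basis" for i j d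
    proof -
      from that obtain s where d: "d = axis s 1" by (auto simp: Basis_vec_def)
      have "C_k k (\<lambda>u. pderiv_at s (inverse_entry i j) u)"
        unfolding pderiv_inverse_entry using Suc J by (intro C_k_intros) auto
      then show ?thesis by (simp add: pderiv_at_def d)
    qed
    then show ?case by (simp add: differentiable_inverse_entry)
  qed
  then show ?thesis by (simp add: smooth_def)
qed

lemma smooth_shift_field: "smooth (shift_field i)"
  using smooth_inverse_entry unfolding smooth_def shift_field_def[abs_def] by (auto intro!: C_k_intros)

lemma smooth_euler_field: "smooth (euler_field i)"
  using smooth_inverse_entry smooth_component unfolding smooth_def euler_field_def[abs_def]
      by (auto intro!: C_k_intros)

lemmas differentiable_entry_and_fields =
  smooth_differentiable[OF smooth_jacobian_entry] smooth_differentiable[OF smooth_shift_field]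
  smooth_differentiable[OF smooth_euler_field]

lemma smooth_shift_euler_bracket:
  "(\<Sum>s\<in>UNIV. shift_field s u * pderiv_at s (euler_field i) u - euler_field s u * pderiv_at s (shift_field i) u)
    = shift_field i u"
proof (rule shift_euler_bracket[OF inverse_entry_entry])
  note inv = matrix_inv_of_invertible(1)[OF invert]
  show "pderiv_at s (jacobian_entry a i) u = pderiv_at i (jacobian_entry a s) u" for s a i
    unfolding jacobian_entry_def by (rule pderiv_at_commute[OF smooth_component])
  have Je: "(\<Sum>i\<in>UNIV. jacobian_entry a i v * shift_field i v) = 1" for a v
    using right_inverse_apply[OF inv, where a = a and y = "\<lambda>_. 1"]
        by (simp add: jacobian_eq_entry shift_field_def inverse_entry_def)
  then show "(\<Sum>i\<in>UNIV. jacobian_entry a i u * shift_field i u) = 1" for a .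
  have JX: "(\<Sum>i\<in>UNIV. jacobian_entry a i v * euler_field i v) = F v $ a" for a v
    using right_inverse_apply[OF inv, where a = a and y = "\<lambda>k. F v $ k"]
    by (simp add: jacobian_eq_entry euler_field_def inverse_entry_def)
  show "(\<Sum>i\<in>UNIV. pderiv_at s (jacobian_entry a i) u * shift_field i u
      + jacobian_entry a i u * pderiv_at s (shift_field i) u) = 0"
      for a s
    using pderiv_at_sum_mult[of "jacobian_entry a" u shift_field s, OF differentiable_entry_and_fields(1,2)]
    by (simp add: Je pderiv_at_const)
  show "(\<Sum>i\<in>UNIV. pderiv_at s (jacobian_entry a i) u * euler_field i u
      + jacobian_entry a i u * pderiv_at s (euler_field i) u)
      = jacobian_entry a s u" for a s
    using pderiv_at_sum_mult[of "jacobian_entry a" u euler_field s, OF differentiable_entry_and_fields(1,3)]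
    unfolding JX unfolding jacobian_entry_def by simp
qed

lemma smooth_phi_wedge:
  "smooth_phi F i j u v = euler_field i u * shift_field j v - shift_field i u * euler_field j v"
proof -
  have "smooth_phi F i j u v
      = (\<Sum>k\<in>UNIV. \<Sum>l\<in>UNIV. inverse_entry i k u * F u $ k * inverse_entry j l v)
      - (\<Sum>k\<in>UNIV. \<Sum>l\<in>UNIV. inverse_entry i k u * (inverse_entry j l v * F v $ l))"
    unfolding smooth_phi_def sum_subtractf[symmetric] inverse_entry_def
    by (intro sum.cong refl) (simp add: algebra_simps)
  then show ?thesis by (simp add: euler_field_def shift_field_def sum_product)
qed

lemma pderiv_smooth_phi:
  "pderiv_at s (\<lambda>u. smooth_phi F i j u v) u
    = pderiv_at s (euler_field i) u * shift_field j v - pderiv_at s (shift_field i) u * euler_field j v"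
  unfolding smooth_phi_wedge by (intro pderiv_at_combination differentiable_entry_and_fields)

lemma smooth_skew_phi: "smooth_skew (smooth_phi F)"
  by (simp add: smooth_skew_def smooth_phi_wedge mult.commute)

lemma smooth_phi_on_pairs: "smooth (\<lambda>(u, v). smooth_phi F i j u v)"
  using smooth_fst_snd_times[OF smooth_euler_field smooth_shift_field, of i j]
    smooth_fst_snd_times[OF smooth_shift_field smooth_euler_field, of i j]
  unfolding smooth_phi_wedge case_prod_beta smooth_def by (auto intro: C_k_diff)

lemma smooth_CYBE_phi: "smooth_CYBE_solution (smooth_phi F)"
  unfolding smooth_CYBE_solution_def
  by (intro conjI allI smooth_skew_phi smooth_phi_on_pairs, unfold pderiv_smooth_phi, unfold smooth_phi_wedge)
    (intro wedge_solves_CYBE smooth_shift_euler_bracket)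

end

theorem theorem3p1:
  "(\<forall>F :: 'n::finite laurent ^ 'n.
      invertible (laurent_jacobian F) \<longrightarrow>
      laurent_skew (laurent_phi F) \<and> laurent_CYBE_solution (laurent_phi F)) \<and>
   (\<forall>F :: real ^ 'n \<Rightarrow> real ^ 'n.
      diffeomorphism F \<and> (\<forall>u. invertible (jacobian F (at u))) \<longrightarrow>
      smooth_skew (smooth_phi F) \<and> smooth_CYBE_solution (smooth_phi F))"
  by (simp add: laurent_skew_phi laurent_CYBE_phi smooth_skew_phi smooth_CYBE_phi)

end
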